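(* Let $k$ be a field of characteristic different from $2$ and let $t\in k$ with $t\neq 0$ and $t^2\neq 1$. Let $E$ be the projective Edwards curve over $k$ with parameter $t$, with addition $\oplus$ (both constructed in the context). Then $(E,\oplus)$ is an abelian group.
   Context: Let $e(x,y)=x^2+y^2-1-t^2x^2y^2$, let $E_{\mathrm{aff}}=\{(x,y)\in k^2\mid e(x,y)=0\}$, and let $E^\circ\subset E_{\mathrm{aff}}$ be the subset of points with $x\neq 0$ and $y\neq 0$. Define $\tau(x,y)=(1/(tx),1/(ty))$, which maps $E^\circ$ to itself and is an involution there. The set $E$ is obtained from two copies of $E_{\mathrm{aff}}$, indexed by $i\in\mathbb{F}_2=\mathbb{Z}/2\mathbb{Z}$, by gluing along $E^\circ$ via $\tau$: writing $[P,i]\in E$ for the image of $P\in E_{\mathrm{aff}}$ in the $i$-th copy, the identifications are exactly $[P,i]=[\tau P,i+1]$ for $P\in E^\circ$, $i\in\mathbb{F}_2$. For $P=(x_1,y_1)$ and $Q=(x_2,y_2)$ set $$\delta_0(P,Q)=(1-t^2x_1x_2y_1y_2)(1+t^2x_1x_2y_1y_2),\qquad \delta_1(P,Q)=(x_2y_1-x_1y_2)(x_1x_2+y_1y_2),$$ $$P\oplus_0Q=\left(\frac{x_1x_2-y_1y_2}{1-t^2x_1x_2y_1y_2},\frac{x_1y_2+y_1x_2}{1+t^2x_1x_2y_1y_2}\right)\ \text{if }\delta_0(P,Q)\neq0,$$ $$P\oplus_1Q=\left(\frac{x_1y_1-x_2y_2}{x_2y_1-x_1y_2},\frac{x_1y_1+x_2y_2}{x_1x_2+y_1y_2}\right)\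 \text{if }\delta_1(P,Q)\neq0.$$ The addition on $E$ is given by the rule $$[P,i]\oplus[Q,j]=[P\oplus_\ell Q,\,i+j]\quad\text{if }\delta_\ell(P,Q)\neq 0,\ \ell\in\mathbb{F}_2,$$ applied to any representatives $[P,i]$, $[Q,j]$ ($P,Q\in E_{\mathrm{aff}}$) of the two elements and any $\ell$ for which it applies. That $(E,\oplus)$ is a group is understood to include that this rule assigns exactly one value in $E$ to each pair of elements of $E$. *)

theory Defs
  imports "HOL-Algebra.Group" "HOL-Library.Z2"
begin

definition edwards_e :: "'a::field \<Rightarrow> 'a \<Rightarrow> 'a \<Rightarrow> 'a" where
  "edwards_e t x y = x\<^sup>2 + y\<^sup>2 - 1 - t\<^sup>2 * x\<^sup>2 * y\<^sup>2"

definition E_aff :: "'a::field \<Rightarrow> ('a \<times> 'a) set" where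
  "E_aff t = {(x, y). edwards_e t x y = 0}"

definition E_circ :: "'a::field \<Rightarrow> ('a \<times> 'a) set" where
  "E_circ t = {(x, y) \<in> E_aff t. x \<noteq> 0 \<and> y \<noteq> 0}"

fun tau :: "'a::field \<Rightarrow> 'a \<times> 'a \<Rightarrow> 'a \<times> 'a" where
  "tau t (x, y) = (1 / (t * x), 1 / (t * y))"

text \<open>The index set \<open>\<F>\<^sub>2\<close> is the type \<^typ>\<open>bit\<close>. The following relation is exactly
  "same point, same copy" or "related by \<open>\<tau>\<close>, opposite copies"; it is already an equivalence
  relation (lemma \<open>equiv_glue\<close>), because \<open>\<tau>\<close> is an involution of \<open>E_circ t\<close>.\<close>

definition glue :: "'a::field \<Rightarrow> (('a \<times> 'a) \<times> bit) rel" where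
  "glue t = {((P, i), (Q, j)). P \<in> E_aff t \<and> Q \<in> E_aff t \<and>
     (P = Q \<and> i = j \<or> P \<in> E_circ t \<and> Q = tau t P \<and> j = i + 1)}"

definition edwards_E :: "'a::field \<Rightarrow> (('a \<times> 'a) \<times> bit) set set" where
  "edwards_E t = (E_aff t \<times> UNIV) // glue t"

definition pt_class :: "'a::field \<Rightarrow> 'a \<times> 'a \<Rightarrow> bit \<Rightarrow> (('a \<times> 'a) \<times> bit) set" where
  "pt_class t P i = glue t `` {(P, i)}"

fun delta0 :: "'a::field \<Rightarrow> 'a \<times> 'a \<Rightarrow> 'a \<times> 'a \<Rightarrow> 'a" where
  "delta0 t (x1, y1) (x2, y2) =
     (1 - t\<^sup>2 * x1 * x2 * y1 * y2) * (1 + t\<^sup>2 * x1 * x2 * y1 * y2)"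

fun delta1 :: "'a::field \<times> 'a \<Rightarrow> 'a \<times> 'a \<Rightarrow> 'a" where
  "delta1 (x1, y1) (x2, y2) = (x2 * y1 - x1 * y2) * (x1 * x2 + y1 * y2)"

fun oplus0 :: "'a::field \<Rightarrow> 'a \<times> 'a \<Rightarrow> 'a \<times> 'a \<Rightarrow> 'a \<times> 'a" where
  "oplus0 t (x1, y1) (x2, y2) =
     ((x1 * x2 - y1 * y2) / (1 - t\<^sup>2 * x1 * x2 * y1 * y2),
      (x1 * y2 + y1 * x2) / (1 + t\<^sup>2 * x1 * x2 * y1 * y2))"

fun oplus1 :: "'a::field \<times> 'a \<Rightarrow> 'a \<times> 'a \<Rightarrow> 'a \<times> 'a" where
  "oplus1 (x1, y1) (x2, y2) =
     ((x1 * y1 - x2 * y2) / (x2 * y1 - x1 * y2),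
      (x1 * y1 + x2 * y2) / (x1 * x2 + y1 * y2))"

definition delta :: "'a::field \<Rightarrow> bit \<Rightarrow> 'a \<times> 'a \<Rightarrow> 'a \<times> 'a \<Rightarrow> 'a" where
  "delta t l P Q = (if l = 0 then delta0 t P Q else delta1 P Q)"

definition oplus :: "'a::field \<Rightarrow> bit \<Rightarrow> 'a \<times> 'a \<Rightarrow> 'a \<times> 'a \<Rightarrow> 'a \<times> 'a" where
  "oplus t l P Q = (if l = 0 then oplus0 t P Q else oplus1 P Q)"

text \<open>\<open>sum_rule t X Y Z\<close>: the addition rule, for some choice of representatives of \<open>X\<close> and \<open>Y\<close>
  and some applicable \<open>l\<close>, yields the value \<open>Z\<close>. Well-definedness is not built in.\<close>

definition sum_rule :: "'a::field \<Rightarrow> (('a \<times> 'a) \<times> bit) set \<Rightarrow> (('a \<times> 'a) \<times> bit) set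
    \<Rightarrow> (('a \<times> 'a) \<times> bit) set \<Rightarrow> bool" where
  "sum_rule t X Y Z \<longleftrightarrow> (\<exists>P\<in>E_aff t. \<exists>Q\<in>E_aff t. \<exists>i j l.
     X = pt_class t P i \<and> Y = pt_class t Q j \<and> delta t l P Q \<noteq> 0 \<and>
     Z = pt_class t (oplus t l P Q) (i + j))"

definition edwards_add :: "'a::field \<Rightarrow> (('a \<times> 'a) \<times> bit) set \<Rightarrow> (('a \<times> 'a) \<times> bit) set
    \<Rightarrow> (('a \<times> 'a) \<times> bit) set" where
  "edwards_add t X Y = (THE Z. sum_rule t X Y Z)"

lemma tau_E_circ:
  assumes "t \<noteq> 0" "P \<in> E_circ t"
  shows "tau t P \<in> E_circ t" "tau t (tau t P) = P"
proof -
  obtain x y where P: "P = (x, y)" by (cases P)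
  from assms(2) have xy: "x \<noteq> 0" "y \<noteq> 0" and
    e: "x\<^sup>2 + y\<^sup>2 - 1 - t\<^sup>2 * x\<^sup>2 * y\<^sup>2 = 0"
    by (auto simp: P E_circ_def E_aff_def edwards_e_def)
  have "edwards_e t (1 / (t * x)) (1 / (t * y)) =
      (x\<^sup>2 + y\<^sup>2 - 1 - t\<^sup>2 * x\<^sup>2 * y\<^sup>2) / (t\<^sup>2 * x\<^sup>2 * y\<^sup>2)"
    using xy assms(1) by (simp add: edwards_e_def power2_eq_square divide_simps)
  then show "tau t P \<in> E_circ t"
    using xy assms(1) e by (simp add: P E_circ_def E_aff_def)
  show "tau t (tau t P) = P"
    using xy assms(1) by (simp add: P)
qed

lemma equiv_glue:
  assumes "t \<noteq> 0"
  shows "equiv (E_aff t \<times> UNIV) (glue t)"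
proof (rule equivI)
  show "glue t \<subseteq> (E_aff t \<times> UNIV) \<times> (E_aff t \<times> UNIV)"
    by (auto simp: glue_def)
  show "refl_on (E_aff t \<times> UNIV) (glue t)"
    by (auto simp: glue_def refl_on_def)
  show "sym (glue t)"
    using tau_E_circ[OF assms] by (auto simp: glue_def sym_def add.assoc)
  show "trans (glue t)"
    using tau_E_circ[OF assms] by (auto simp: glue_def trans_def add.assoc)
qed

end

theory Submission
  imports Defs
begin

text \<open>
  The map \<open>[(x, y), 0] \<mapsto> ((x : 1), (y : 1))\<close>, \<open>[(x, y), 1] \<mapsto> ((1 : t x), (1 : t y))\<close> embeds \<open>E\<close>
  into the product of two projective lines, the glueing being exactly equality of images. In
  homogeneous coordinates both addition laws are bihomogeneous, they are proportional on the curve,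
  and the translations \<open>\<tau>\<close> and \<open>(x, y) \<mapsto> (-y, x)\<close> commute with addition; \<open>\<tau>\<close> swaps the two laws.
  In each coordinate at least one law is nonzero, which gives uniqueness of the sum.
  For associativity of \<open>P + Q + R\<close>, replacing \<open>P\<close> and \<open>R\<close> by their translates under \<open>\<tau>\<close> makes
  law 0 nonzero for the two inner sums. Each outer sum is then computed by either law, and the
  four resulting equations for the \<open>x\<close>-coordinates are polynomial identities modulo the curve
  equations. The \<open>y\<close>-coordinates follow by rotating \<open>P\<close>.
\<close>

section \<open>Points in a product of two projective lines\<close>

text \<open>\<open>((X, Z), (Y, W))\<close> stands for the point \<open>x = (X : Z)\<close>, \<open>y = (Y : W)\<close>, which is a genuine
  point only if both pairs are nonzero. The zero pair is proportional to every pair.\<close>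

type_synonym 'a pp = "('a \<times> 'a) \<times> ('a \<times> 'a)"

definition nz :: "'a::field \<times> 'a \<Rightarrow> bool" where
  "nz u \<longleftrightarrow> u \<noteq> (0, 0)"

definition proportional :: "'a::field \<times> 'a \<Rightarrow> 'a \<times> 'a \<Rightarrow> bool" where
  "proportional u v \<longleftrightarrow> fst u * snd v = fst v * snd u"

definition sim :: "'a::field pp \<Rightarrow> 'a pp \<Rightarrow> bool" where
  "sim p q \<longleftrightarrow> proportional (fst p) (fst q) \<and> proportional (snd p) (snd q)"

fun on_curve :: "'a::field \<Rightarrow> 'a pp \<Rightarrow> bool" where
  "on_curve t ((X, Z), (Y, W)) \<longleftrightarrow> nz (X, Z) \<and> nz (Y, W) \<and>
     X\<^sup>2 * W\<^sup>2 + Y\<^sup>2 * Z\<^sup>2 = Z\<^sup>2 * W\<^sup>2 + t\<^sup>2 * X\<^sup>2 * Y\<^sup>2"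

text \<open>The four laws are the numerators and denominators of the affine coordinates of
  \<open>oplus0\<close> and \<open>oplus1\<close>, homogenised by x = X/Z, y = Y/W. The coordinates
  are kept apart because they degenerate separately.\<close>

fun x_law0 :: "'a::field \<Rightarrow> 'a pp \<Rightarrow> 'a pp \<Rightarrow> 'a \<times> 'a" where
  "x_law0 t ((X1, Z1), (Y1, W1)) ((X2, Z2), (Y2, W2)) =
     (X1 * X2 * W1 * W2 - Y1 * Y2 * Z1 * Z2, Z1 * Z2 * W1 * W2 - t\<^sup>2 * X1 * X2 * Y1 * Y2)"

fun y_law0 :: "'a::field \<Rightarrow> 'a pp \<Rightarrow> 'a pp \<Rightarrow> 'a \<times> 'a" where
  "y_law0 t ((X1, Z1), (Y1, W1)) ((X2, Z2), (Y2, W2)) =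
     (X1 * Y2 * W1 * Z2 + Y1 * X2 * Z1 * W2, Z1 * Z2 * W1 * W2 + t\<^sup>2 * X1 * X2 * Y1 * Y2)"

fun x_law1 :: "'a::field pp \<Rightarrow> 'a pp \<Rightarrow> 'a \<times> 'a" where
  "x_law1 ((X1, Z1), (Y1, W1)) ((X2, Z2), (Y2, W2)) =
     (X1 * Y1 * Z2 * W2 - X2 * Y2 * Z1 * W1, X2 * Y1 * Z1 * W2 - X1 * Y2 * W1 * Z2)"

fun y_law1 :: "'a::field pp \<Rightarrow> 'a pp \<Rightarrow> 'a \<times> 'a" where
  "y_law1 ((X1, Z1), (Y1, W1)) ((X2, Z2), (Y2, W2)) =
     (X1 * Y1 * Z2 * W2 + X2 * Y2 * Z1 * W1, X1 * X2 * W1 * W2 + Y1 * Y2 * Z1 * Z2)"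

text \<open>Requiring both laws at once makes the choice of a law unnecessary: a law that degenerates to
  the zero pair imposes no condition.\<close>

definition is_sum :: "'a::field \<Rightarrow> 'a pp \<Rightarrow> 'a pp \<Rightarrow> 'a pp \<Rightarrow> bool" where
  "is_sum t p q r \<longleftrightarrow> proportional (fst r) (x_law0 t p q) \<and> proportional (fst r) (x_law1 p q) \<and>
     proportional (snd r) (y_law0 t p q) \<and> proportional (snd r) (y_law1 p q)"

text \<open>\<open>tau_pp\<close> and \<open>rot\<close> are translations by torsion points; the first interchanges the two laws,
  the second the two coordinates.\<close>

fun tau_pp :: "'a::field \<Rightarrow> 'a pp \<Rightarrow> 'a pp" where
  "tau_pp t ((X, Z), (Y, W)) = ((Z, t * X), (W, t * Y))"

fun rot :: "'a::field pp \<Rightarrow> 'a pp" where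
  "rot ((X, Z), (Y, W)) = ((- Y, W), (X, Z))"

section \<open>Proportional pairs and nonzero scalars\<close>

lemma on_curve_nz: "on_curve t p \<Longrightarrow> nz (fst p) \<and> nz (snd p)"
  by (cases p) auto

lemma proportional_sym: "proportional u v \<Longrightarrow> proportional v u"
  by (simp add: proportional_def)

text \<open>Both entries of \<open>v\<close> annihilate the cross product of \<open>u\<close> and
  \<open>w\<close>, and one of them is nonzero. A zero \<open>v\<close> would relate any two
  pairs.\<close>

lemma proportional_trans:
  assumes "proportional u v" "proportional v w" "nz v"
  shows "proportional u w"
proof -
  have "fst v * (fst u * snd w - fst w * snd u) = 0" "snd v * (fst u * snd w - fst w * snd u) = 0"
    using assms(1,2) unfolding proportional_def by algebra+
  then show ?thesis
    using assms(3) by (auto simp: proportional_def nz_def prod_eq_iff)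
qed

lemma proportional_scale:
  assumes "proportional u v" "nz u" "nz v"
  obtains k where "k \<noteq> 0" "u = (k * fst v, k * snd v)"
proof (cases "fst v = 0")
  case True
  then have "fst u = 0" "snd v \<noteq> 0" "snd u \<noteq> 0"
    using assms by (auto simp: proportional_def nz_def prod_eq_iff)
  then show ?thesis
    using True by (intro that[of "snd u / snd v"]) (auto simp: prod_eq_iff)
next
  case False
  then have "fst u \<noteq> 0"
    using assms by (auto simp: proportional_def nz_def prod_eq_iff)
  then show ?thesis
    using False assms(1)
    by (intro that[of "fst u / fst v"]) (auto simp: prod_eq_iff proportional_def field_simps)
qed

lemma sim_sym: "sim p q \<Longrightarrow> sim q p"
  by (simp add: sim_def proportional_sym)

lemma sim_scale:
  assumes "sim p q" "nz (fst p)" "nz (snd p)" "nz (fst q)" "nz (snd q)"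
  obtains k l where "k \<noteq> 0" "l \<noteq> 0"
    "p = ((k * fst (fst q), k * snd (fst q)), (l * fst (snd q), l * snd (snd q)))"
proof -
  obtain k where "k \<noteq> 0" "fst p = (k * fst (fst q), k * snd (fst q))"
    using assms proportional_scale unfolding sim_def by blast
  moreover obtain l where "l \<noteq> 0" "snd p = (l * fst (snd q), l * snd (snd q))"
    using assms proportional_scale unfolding sim_def by blast
  ultimately show ?thesis
    by (intro that[of k l]) (auto simp: prod_eq_iff)
qed

lemma proportional_scale_right [simp]:
  "(c::'a::field) \<noteq> 0 \<Longrightarrow> proportional u (c * a, c * b) \<longleftrightarrow> proportional u (a, b)"
  by (auto simp: proportional_def)

lemma proportional_scale_left [simp]:
  "(c::'a::field) \<noteq> 0 \<Longrightarrow> proportional (c * a, c * b) u \<longleftrightarrow> proportional (a, b) u"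
  by (auto simp: proportional_def)

lemma nz_scale [simp]: "(c::'a::field) \<noteq> 0 \<Longrightarrow> nz (c * a, c * b) \<longleftrightarrow> nz (a, b)"
  by (auto simp: nz_def)

section \<open>Symmetries of the addition laws\<close>

text \<open>Each law is linear in either coordinate pair of \<open>p\<close>, so both entries
  acquire the same factor.\<close>

lemma law_scale:
  fixes k l :: "'a::field"
  assumes "p' = ((k * fst (fst p), k * snd (fst p)), (l * fst (snd p), l * snd (snd p)))"
  shows "x_law0 t p' q = (k * l * fst (x_law0 t p q), k * l * snd (x_law0 t p q))"
    "y_law0 t p' q = (k * l * fst (y_law0 t p q), k * l * snd (y_law0 t p q))"
    "x_law1 p' q = (k * l * fst (x_law1 p q), k * l * snd (x_law1 p q))"
    "y_law1 p' q = (k * l * fst (y_law1 p q), k * l * snd (y_law1 p q))"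
  unfolding assms by (cases "(t, p, q)" rule: x_law0.cases, simp add: algebra_simps)+

lemma law_commute:
  "x_law0 t q p = x_law0 t p q"
  "y_law0 t q p = y_law0 t p q"
  "x_law1 q p = (- fst (x_law1 p q), - snd (x_law1 p q))"
  "y_law1 q p = y_law1 p q"
  by (cases "(t, p, q)" rule: x_law0.cases, simp add: algebra_simps)+

text \<open>Only \<open>x_law1\<close> is not symmetric; it changes by an overall sign, which
  proportionality does not see.\<close>

lemma is_sum_commute: "is_sum t q p r \<longleftrightarrow> is_sum t p q r"
  by (simp add: is_sum_def law_commute(1,2)[of t q p] law_commute(3,4)[of q p] proportional_def)

text \<open>On one coordinate \<open>tau_pp\<close> sends (a, b) to (b, t a). The right-hand sides
  are this map applied to the other law, up to a common factor \<open>t\<close>.\<close>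

lemma law_tau:
  "x_law0 t (tau_pp t p) q = (t * snd (x_law1 p q), t\<^sup>2 * fst (x_law1 p q))"
  "y_law0 t (tau_pp t p) q = (t * snd (y_law1 p q), t\<^sup>2 * fst (y_law1 p q))"
  "x_law1 (tau_pp t p) q = (snd (x_law0 t p q), t * fst (x_law0 t p q))"
  "y_law1 (tau_pp t p) q = (snd (y_law0 t p q), t * fst (y_law0 t p q))"
  by (cases "(t, p, q)" rule: x_law0.cases, simp add: algebra_simps power2_eq_square)+

lemma law_rot:
  "x_law0 t (rot p) q = (- fst (y_law0 t p q), snd (y_law0 t p q))"
  "y_law0 t (rot p) q = x_law0 t p q"
  "x_law1 (rot p) q = (- fst (y_law1 p q), snd (y_law1 p q))"
  "y_law1 (rot p) q = (- fst (x_law1 p q), - snd (x_law1 p q))"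
  by (cases "(t, p, q)" rule: x_law0.cases, simp add: algebra_simps)+

text \<open>The linear map (a, b) to (b, c a) multiplies cross products by -c. For c = t it is the
  effect of \<open>tau_pp\<close> on one coordinate.\<close>

lemma proportional_swap:
  fixes c :: "'a::field"
  assumes "c \<noteq> 0"
  shows "proportional (snd u, c * fst u) (snd v, c * fst v) \<longleftrightarrow> proportional u v"
proof -
  have "proportional (snd u, c * fst u) (snd v, c * fst v) \<longleftrightarrow>
      c * (snd u * fst v) = c * (snd v * fst u)"
    by (simp add: proportional_def mult.left_commute)
  also have "\<dots> \<longleftrightarrow> snd u * fst v = snd v * fst u"
    using assms by simp
  also have "\<dots> \<longleftrightarrow> proportional u v"
    unfolding proportional_def by (metis mult.commute)
  finally show ?thesis .
qed

lemma proportional_neg: "proportional (- fst u, snd u) (- fst v, snd v) \<longleftrightarrow> proportional u v"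
  by (simp add: proportional_def)

text \<open>Exchanging the two laws only permutes the conditions in \<open>is_sum\<close>, which
  demands both.\<close>

lemma is_sum_tau_left:
  assumes "t \<noteq> 0"
  shows "is_sum t (tau_pp t p) q (tau_pp t r) \<longleftrightarrow> is_sum t p q r"
proof -
  have *: "(t * a, t\<^sup>2 * b) = (t * a, t * (t * b))" for a b
    by (simp add: power2_eq_square)
  have "tau_pp t r = ((snd (fst r), t * fst (fst r)), (snd (snd r), t * fst (snd r)))"
    by (cases "(t, r)" rule: tau_pp.cases) simp
  then show ?thesis
    using assms by (simp add: is_sum_def law_tau proportional_swap * conj_ac del: prod.inject)
qed

lemma is_sum_tau_right:
  assumes "t \<noteq> 0"
  shows "is_sum t p (tau_pp t q) (tau_pp t r) \<longleftrightarrow> is_sum t p q r"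
  using is_sum_tau_left[OF assms] by (simp add: is_sum_commute)

lemma is_sum_tau_tau:
  assumes "t \<noteq> 0"
  shows "is_sum t (tau_pp t p) (tau_pp t q) r \<longleftrightarrow> is_sum t p q r"
proof -
  \<comment> \<open>Applying \<open>tau_pp\<close> twice multiplies every coordinate by
    \<open>t\<close>, so it fixes the point.\<close>
  have "is_sum t (tau_pp t p) (tau_pp t q) r \<longleftrightarrow>
      is_sum t (tau_pp t p) (tau_pp t q) (tau_pp t (tau_pp t r))"
    using assms by (cases "(t, r)" rule: tau_pp.cases) (auto simp: is_sum_def)
  then show ?thesis
    by (simp add: is_sum_tau_left is_sum_tau_right assms)
qed

text \<open>Serves to deduce statements on second coordinates from statements on first ones.\<close>

lemma is_sum_rot: "is_sum t (rot p) q (rot r) \<longleftrightarrow> is_sum t p q r"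
proof -
  have *: "proportional u (- a, - b) \<longleftrightarrow> proportional u (a, b)" for u :: "'a \<times> 'a" and a b
    by (simp add: proportional_def)
  have "rot r = ((- fst (snd r), snd (snd r)), fst r)"
    by (cases r rule: rot.cases) simp
  then show ?thesis
    by (simp add: is_sum_def law_rot proportional_neg * conj_ac)
qed

lemma on_curve_tau:
  assumes "t \<noteq> 0"
  shows "on_curve t (tau_pp t p) \<longleftrightarrow> on_curve t p"
proof (cases "(t, p)" rule: tau_pp.cases)
  case (1 t' X Z Y W)
  have "Z\<^sup>2 * (t * Y)\<^sup>2 + W\<^sup>2 * (t * X)\<^sup>2 = t\<^sup>2 * (X\<^sup>2 * W\<^sup>2 + Y\<^sup>2 * Z\<^sup>2)"
    "(t * X)\<^sup>2 * (t * Y)\<^sup>2 + t\<^sup>2 * Z\<^sup>2 * W\<^sup>2 =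
      t\<^sup>2 * (Z\<^sup>2 * W\<^sup>2 + t\<^sup>2 * X\<^sup>2 * Y\<^sup>2)"
    by (simp_all add: algebra_simps)
  then have "Z\<^sup>2 * (t * Y)\<^sup>2 + W\<^sup>2 * (t * X)\<^sup>2 = (t * X)\<^sup>2 * (t * Y)\<^sup>2 + t\<^sup>2 * Z\<^sup>2 * W\<^sup>2
      \<longleftrightarrow> X\<^sup>2 * W\<^sup>2 + Y\<^sup>2 * Z\<^sup>2 = Z\<^sup>2 * W\<^sup>2 + t\<^sup>2 * X\<^sup>2 * Y\<^sup>2"
    using assms by simp
  moreover have "nz (Z, t * X) \<longleftrightarrow> nz (X, Z)" "nz (W, t * Y) \<longleftrightarrow> nz (Y, W)"
    using assms by (auto simp: nz_def)
  ultimately show ?thesis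
    using 1 by (simp add: algebra_simps)
qed

lemma on_curve_rot: "on_curve t (rot p) \<longleftrightarrow> on_curve t p"
proof (cases p rule: rot.cases)
  case (1 X Z Y W)
  have "nz (- Y, W) \<longleftrightarrow> nz (Y, W)"
    by (simp add: nz_def)
  then show ?thesis
    using 1 by (simp add: algebra_simps conj_ac)
qed

section \<open>Polynomial identities modulo the curve equations\<close>

text \<open>The cross product of the two laws lies in the ideal generated by the two curve
  equations.\<close>

lemma proportional_law:
  assumes "on_curve t p" "on_curve t q"
  shows "proportional (x_law0 t p q) (x_law1 p q)" "proportional (y_law0 t p q) (y_law1 p q)"
proof -
  obtain X1 Z1 Y1 W1 where p: "p = ((X1, Z1), (Y1, W1))" by (metis prod.collapse)
  obtain X2 Z2 Y2 W2 where q: "q = ((X2, Z2), (Y2, W2))" by (metis prod.collapse)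
  have e: "X1\<^sup>2 * W1\<^sup>2 + Y1\<^sup>2 * Z1\<^sup>2 = Z1\<^sup>2 * W1\<^sup>2 + t\<^sup>2 * X1\<^sup>2 * Y1\<^sup>2"
    "X2\<^sup>2 * W2\<^sup>2 + Y2\<^sup>2 * Z2\<^sup>2 = Z2\<^sup>2 * W2\<^sup>2 + t\<^sup>2 * X2\<^sup>2 * Y2\<^sup>2"
    using assms by (simp_all add: p q)
  show "proportional (x_law0 t p q) (x_law1 p q)"
    unfolding p q proportional_def x_law0.simps x_law1.simps fst_conv snd_conv using e by algebra
  show "proportional (y_law0 t p q) (y_law1 p q)"
    unfolding p q proportional_def y_law0.simps y_law1.simps fst_conv snd_conv using e by algebra
qed

text \<open>Four combinations occur because either law may degenerate in each outer sum. Each cross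
  product lies in the ideal of the three curve equations; nondegeneracy enters only when these
  relations are chained.\<close>

lemma proportional_assoc:
  assumes "on_curve t p" "on_curve t q" "on_curve t r"
  defines "a \<equiv> (x_law0 t p q, y_law0 t p q)" and "c \<equiv> (x_law0 t q r, y_law0 t q r)"
  shows "proportional (x_law0 t a r) (x_law0 t p c)" "proportional (x_law0 t a r) (x_law1 p c)"
    "proportional (x_law1 a r) (x_law0 t p c)" "proportional (x_law1 a r) (x_law1 p c)"
proof -
  obtain X1 Z1 Y1 W1 where p: "p = ((X1, Z1), (Y1, W1))" by (metis prod.collapse)
  obtain X2 Z2 Y2 W2 where q: "q = ((X2, Z2), (Y2, W2))" by (metis prod.collapse)
  obtain X3 Z3 Y3 W3 where r: "r = ((X3, Z3), (Y3, W3))" by (metis prod.collapse)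
  have e: "X1\<^sup>2 * W1\<^sup>2 + Y1\<^sup>2 * Z1\<^sup>2 = Z1\<^sup>2 * W1\<^sup>2 + t\<^sup>2 * X1\<^sup>2 * Y1\<^sup>2"
    "X2\<^sup>2 * W2\<^sup>2 + Y2\<^sup>2 * Z2\<^sup>2 = Z2\<^sup>2 * W2\<^sup>2 + t\<^sup>2 * X2\<^sup>2 * Y2\<^sup>2"
    "X3\<^sup>2 * W3\<^sup>2 + Y3\<^sup>2 * Z3\<^sup>2 = Z3\<^sup>2 * W3\<^sup>2 + t\<^sup>2 * X3\<^sup>2 * Y3\<^sup>2"
    using assms by (simp_all add: p q r)
  note s = a_def c_def p q r proportional_def x_law0.simps x_law1.simps y_law0.simps fst_conv snd_conv
  show "proportional (x_law0 t a r) (x_law0 t p c)"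
    unfolding s using e by algebra
  show "proportional (x_law0 t a r) (x_law1 p c)"
    unfolding s using e by algebra
  show "proportional (x_law1 a r) (x_law0 t p c)"
    unfolding s using e by algebra
  show "proportional (x_law1 a r) (x_law1 p c)"
    unfolding s using e by algebra
qed

section \<open>Nondegeneracy of the addition laws\<close>

lemma nz_law_tau:
  assumes "t \<noteq> 0"
  shows "nz (x_law0 t (tau_pp t p) q) \<longleftrightarrow> nz (x_law1 p q)"
    "nz (y_law0 t (tau_pp t p) q) \<longleftrightarrow> nz (y_law1 p q)"
    "nz (x_law1 (tau_pp t p) q) \<longleftrightarrow> nz (x_law0 t p q)"
    "nz (y_law1 (tau_pp t p) q) \<longleftrightarrow> nz (y_law0 t p q)"
  using assms by (auto simp: law_tau nz_def prod_eq_iff)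

lemma nz_law_commute:
  "nz (x_law0 t p q) \<longleftrightarrow> nz (x_law0 t q p)" "nz (y_law0 t p q) \<longleftrightarrow> nz (y_law0 t q p)"
  "nz (x_law1 p q) \<longleftrightarrow> nz (x_law1 q p)" "nz (y_law1 p q) \<longleftrightarrow> nz (y_law1 q p)"
  by (simp_all add: law_commute(1,2)[of t q p] law_commute(3,4)[of q p] nz_def prod_eq_iff)

text \<open>Asks both coordinates to be nonzero under the same law, since the inner sums of the
  associativity identities take both coordinates from law 0.\<close>

definition law0_nz :: "'a::field \<Rightarrow> 'a pp \<Rightarrow> 'a pp \<Rightarrow> bool" where
  "law0_nz t p q \<longleftrightarrow> nz (x_law0 t p q) \<and> nz (y_law0 t p q)"

definition law1_nz :: "'a::field pp \<Rightarrow> 'a pp \<Rightarrow> bool" where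
  "law1_nz p q \<longleftrightarrow> nz (x_law1 p q) \<and> nz (y_law1 p q)"

lemma law0_nz_tau:
  assumes "t \<noteq> 0"
  shows "law0_nz t (tau_pp t p) q \<longleftrightarrow> law1_nz p q" "law1_nz (tau_pp t p) q \<longleftrightarrow> law0_nz t p q"
  using nz_law_tau[OF assms] by (auto simp: law0_nz_def law1_nz_def)

lemma law_nz_commute: "law0_nz t p q \<longleftrightarrow> law0_nz t q p" "law1_nz p q \<longleftrightarrow> law1_nz q p"
  unfolding law0_nz_def law1_nz_def by (metis nz_law_commute)+

lemma law_nz_scale:
  assumes "p' = ((k * fst (fst p), k * snd (fst p)), (l * fst (snd p), l * snd (snd p)))"
    "k \<noteq> 0" "l \<noteq> 0"
  shows "law0_nz t p' q \<longleftrightarrow> law0_nz t p q" "law1_nz p' q \<longleftrightarrow> law1_nz p q"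
  using assms(2,3) by (auto simp: law0_nz_def law1_nz_def law_scale[OF assms(1)])

text \<open>If both laws degenerate then, up to sign conflicts excluded by characteristic \<open>\<noteq> 2\<close>, all
  coordinates have the same square \<open>s\<close>, and the curve equation forces \<open>s = 1\<close>, \<open>t\<^sup>2 = 1\<close>.\<close>

lemma law_nz_affine:
  fixes t :: "'a::field"
  assumes "(2::'a) \<noteq> 0" "t\<^sup>2 \<noteq> 1"
    and e1: "x1\<^sup>2 + y1\<^sup>2 = 1 + t\<^sup>2 * x1\<^sup>2 * y1\<^sup>2"
  shows "law0_nz t ((x1, 1), (y1, 1)) ((x2, 1), (y2, 1)) \<or>
    law1_nz ((x1, 1), (y1, 1)) ((x2, 1), (y2, 1))"
proof -
  have no_equal_squares: False if "x1\<^sup>2 = s" "y1\<^sup>2 = s" "t\<^sup>2 * s\<^sup>2 = 1" for s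
  proof -
    have "s + s = 1 + t\<^sup>2 * s\<^sup>2"
      using e1 that(1,2) by (simp add: power2_eq_square mult.assoc)
    then have "2 * (s - 1) = 0"
      using that(3) by (simp add: algebra_simps)
    then show False
      using that(3) assms(1,2) by simp
  qed
  \<comment> \<open>If neither law is nonzero in both coordinates, then some coordinate of law 0 and
    some coordinate of law 1 vanish. The four combinations are excluded in turn: x with x, y with y,
    then the mixed ones.\<close>
  have "\<not> (x1 * x2 = y1 * y2 \<and> t\<^sup>2 * x1 * x2 * y1 * y2 = 1 \<and> x1 * y1 = x2 * y2 \<and> x2 * y1 = x1 * y2)"
  proof
    assume h: "x1 * x2 = y1 * y2 \<and> t\<^sup>2 * x1 * x2 * y1 * y2 = 1 \<and> x1 * y1 = x2 * y2 \<and> x2 * y1 = x1 * y2"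
    have "x2 * y1 \<noteq> 0" "x1 * x2 \<noteq> 0"
      using h by auto
    moreover have "x2 * y1 * (x1\<^sup>2 - y2\<^sup>2) = 0" "x1 * x2 * (y1\<^sup>2 - y2\<^sup>2) = 0" "t\<^sup>2 * (y1 * y2)\<^sup>2 = 1"
      using h by algebra+
    ultimately have "x1\<^sup>2 = y2\<^sup>2" "y1\<^sup>2 = y2\<^sup>2" "t\<^sup>2 * (y1\<^sup>2 * y2\<^sup>2) = 1"
      by (simp_all add: power_mult_distrib)
    then show False
      using no_equal_squares[of "y2\<^sup>2"] by (simp add: power2_eq_square)
  qed
  moreover have "\<not> (x1 * y2 = - (y1 * x2) \<and> t\<^sup>2 * x1 * x2 * y1 * y2 = - 1 \<and>
      x1 * y1 = - (x2 * y2) \<and> x1 * x2 = - (y1 * y2))"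
  proof
    assume h: "x1 * y2 = - (y1 * x2) \<and> t\<^sup>2 * x1 * x2 * y1 * y2 = - 1 \<and>
      x1 * y1 = - (x2 * y2) \<and> x1 * x2 = - (y1 * y2)"
    have "x2 * y1 \<noteq> 0" "x1 * x2 \<noteq> 0"
      using h by auto
    moreover have "x2 * y1 * (x1\<^sup>2 - y2\<^sup>2) = 0" "x1 * x2 * (y1\<^sup>2 - y2\<^sup>2) = 0" "t\<^sup>2 * (y1 * y2)\<^sup>2 = 1"
      using h by algebra+
    ultimately have "x1\<^sup>2 = y2\<^sup>2" "y1\<^sup>2 = y2\<^sup>2" "t\<^sup>2 * (y1\<^sup>2 * y2\<^sup>2) = 1"
      by (simp_all add: power_mult_distrib)
    then show False
      using no_equal_squares[of "y2\<^sup>2"] by (simp add: power2_eq_square)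
  qed
  \<comment> \<open>In the mixed cases a product equals its own negative, hence is zero, although
    \<open>x1 * x2 * y1 * y2\<close> is not.\<close>
  moreover have "\<not> (x1 * x2 = y1 * y2 \<and> t\<^sup>2 * x1 * x2 * y1 * y2 = 1 \<and> x1 * x2 = - (y1 * y2))"
  proof
    assume h: "x1 * x2 = y1 * y2 \<and> t\<^sup>2 * x1 * x2 * y1 * y2 = 1 \<and> x1 * x2 = - (y1 * y2)"
    then have "2 * (x1 * x2) = 0"
      by (metis add.right_inverse mult.commute mult_2)
    with h assms(1) show False by auto
  qed
  moreover have "\<not> (x1 * y2 = - (y1 * x2) \<and> t\<^sup>2 * x1 * x2 * y1 * y2 = - 1 \<and> x2 * y1 = x1 * y2)"
  proof
    assume h: "x1 * y2 = - (y1 * x2) \<and> t\<^sup>2 * x1 * x2 * y1 * y2 = - 1 \<and> x2 * y1 = x1 * y2"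
    then have "2 * (x1 * y2) = 0"
      by (metis add.right_inverse mult.commute mult_2)
    with h assms(1) show False by auto
  qed
  moreover have "nz (x_law0 t ((x1, 1), (y1, 1)) ((x2, 1), (y2, 1))) \<longleftrightarrow>
      \<not> (x1 * x2 = y1 * y2 \<and> t\<^sup>2 * x1 * x2 * y1 * y2 = 1)"
    by (auto simp: nz_def)
  moreover have "nz (y_law0 t ((x1, 1), (y1, 1)) ((x2, 1), (y2, 1))) \<longleftrightarrow>
      \<not> (x1 * y2 = - (y1 * x2) \<and> t\<^sup>2 * x1 * x2 * y1 * y2 = - 1)"
    by (simp add: nz_def eq_neg_iff_add_eq_0 add.commute)
  moreover have "nz (x_law1 ((x1, 1), (y1, 1)) ((x2, 1), (y2, 1))) \<longleftrightarrow>
      \<not> (x1 * y1 = x2 * y2 \<and> x2 * y1 = x1 * y2)"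
    by (simp add: nz_def)
  moreover have "nz (y_law1 ((x1, 1), (y1, 1)) ((x2, 1), (y2, 1))) \<longleftrightarrow>
      \<not> (x1 * y1 = - (x2 * y2) \<and> x1 * x2 = - (y1 * y2))"
    by (simp add: nz_def eq_neg_iff_add_eq_0)
  ultimately show ?thesis
    unfolding law0_nz_def law1_nz_def by argo
qed

text \<open>If Z = 0, the equation reads X^2 W^2 = t^2 X^2 Y^2 and forces X and Y to be nonzero;
  likewise if W = 0. The translate then has the nonzero denominators t X and t Y.\<close>

lemma on_curve_affine_or_tau:
  assumes "t \<noteq> 0" "on_curve t p"
  obtains (affine) "snd (fst p) \<noteq> 0" "snd (snd p) \<noteq> 0"
  | (infinite) "snd (fst (tau_pp t p)) \<noteq> 0" "snd (snd (tau_pp t p)) \<noteq> 0"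
proof (cases "(t, p)" rule: tau_pp.cases)
  case (1 t' X Z Y W)
  then have "Z = 0 \<or> W = 0 \<Longrightarrow> X \<noteq> 0 \<and> Y \<noteq> 0"
    using assms(2) by (auto simp: nz_def)
  then show ?thesis
    using 1 that assms(1) by auto
qed

lemma affine_rep:
  assumes "snd (fst p) \<noteq> 0" "snd (snd p) \<noteq> 0" "on_curve t p"
  obtains x y where "x\<^sup>2 + y\<^sup>2 = 1 + t\<^sup>2 * x\<^sup>2 * y\<^sup>2"
    "p = ((snd (fst p) * x, snd (fst p) * 1), (snd (snd p) * y, snd (snd p) * 1))"
proof -
  obtain X Z Y W where p: "p = ((X, Z), (Y, W))" by (metis prod.collapse)
  have "(X / Z)\<^sup>2 + (Y / W)\<^sup>2 = 1 + t\<^sup>2 * (X / Z)\<^sup>2 * (Y / W)\<^sup>2"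
    using assms by (simp add: p field_simps)
  then show ?thesis
    using assms by (intro that[of "X / Z" "Y / W"]) (auto simp: p)
qed

text \<open>Each argument is affine or becomes so under \<open>tau_pp\<close>, which merely
  exchanges the two alternatives.\<close>

lemma law0_nz_or_law1_nz:
  fixes t :: "'a::field"
  assumes "(2::'a) \<noteq> 0" "t \<noteq> 0" "t\<^sup>2 \<noteq> 1" "on_curve t p" "on_curve t q"
  shows "law0_nz t p q \<or> law1_nz p q"
proof -
  have affine_case: "law0_nz t p q \<or> law1_nz p q"
    if pq: "on_curve t p" "on_curve t q" "snd (fst p) \<noteq> 0" "snd (snd p) \<noteq> 0"
      "snd (fst q) \<noteq> 0" "snd (snd q) \<noteq> 0" for p q
  proof -
    obtain x1 y1 where p: "x1\<^sup>2 + y1\<^sup>2 = 1 + t\<^sup>2 * x1\<^sup>2 * y1\<^sup>2"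
      "p = ((snd (fst p) * x1, snd (fst p) * 1), (snd (snd p) * y1, snd (snd p) * 1))"
      using affine_rep pq by blast
    obtain x2 y2 where q: "x2\<^sup>2 + y2\<^sup>2 = 1 + t\<^sup>2 * x2\<^sup>2 * y2\<^sup>2"
      "q = ((snd (fst q) * x2, snd (fst q) * 1), (snd (snd q) * y2, snd (snd q) * 1))"
      using affine_rep pq by blast
    let ?p = "((x1, 1), (y1, 1))" and ?q = "((x2, 1), (y2, 1))"
    have "law0_nz t p q \<longleftrightarrow> law0_nz t ?p q" "law1_nz p q \<longleftrightarrow> law1_nz ?p q"
      by (rule law_nz_scale[where k = "snd (fst p)" and l = "snd (snd p)"], use p pq in simp_all)+
    moreover have "law0_nz t q ?p \<longleftrightarrow> law0_nz t ?q ?p" "law1_nz q ?p \<longleftrightarrow> law1_nz ?q ?p"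
      by (rule law_nz_scale[where k = "snd (fst q)" and l = "snd (snd q)"], use q pq in simp_all)+
    ultimately show ?thesis
      using law_nz_affine[OF assms(1,3) p(1), of x2 y2] by (metis law_nz_commute)
  qed
  have left: "law0_nz t p q \<or> law1_nz p q"
    if "on_curve t p" "on_curve t q" "snd (fst q) \<noteq> 0" "snd (snd q) \<noteq> 0" for p q
    using \<open>t \<noteq> 0\<close> that(1)
  proof (cases rule: on_curve_affine_or_tau)
    case affine
    then show ?thesis using that affine_case by blast
  next
    case infinite
    then have "law0_nz t (tau_pp t p) q \<or> law1_nz (tau_pp t p) q"
      using that assms(2) by (intro affine_case) (auto simp: on_curve_tau)
    then show ?thesis
      using law0_nz_tau assms(2) by blast
  qed
  show ?thesis
    using \<open>t \<noteq> 0\<close> assms(5)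
  proof (cases rule: on_curve_affine_or_tau)
    case affine
    then show ?thesis using assms left by blast
  next
    case infinite
    then have "law0_nz t p (tau_pp t q) \<or> law1_nz p (tau_pp t q)"
      using assms by (intro left) (auto simp: on_curve_tau)
    then show ?thesis
      using law0_nz_tau assms(2) law_nz_commute by metis
  qed
qed

section \<open>Uniqueness and associativity of sums\<close>

locale edwards =
  fixes t :: "'a::field"
  assumes two_nz: "(2::'a) \<noteq> 0" and t_nz: "t \<noteq> 0" and t_square: "t\<^sup>2 \<noteq> 1"
begin

text \<open>In each coordinate some law is nonzero, and both candidates are proportional to
  it.\<close>

lemma is_sum_unique:
  assumes "on_curve t p" "on_curve t q" "is_sum t p q r" "is_sum t p q r'"
  shows "sim r r'"
proof -
  obtain u where u: "u = x_law0 t p q \<or> u = x_law1 p q" "nz u"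
    using law0_nz_or_law1_nz[OF two_nz t_nz t_square assms(1,2)]
    unfolding law0_nz_def law1_nz_def by blast
  obtain v where v: "v = y_law0 t p q \<or> v = y_law1 p q" "nz v"
    using law0_nz_or_law1_nz[OF two_nz t_nz t_square assms(1,2)]
    unfolding law0_nz_def law1_nz_def by blast
  have "proportional (fst r) u" "proportional u (fst r')"
    "proportional (snd r) v" "proportional v (snd r')"
    using u(1) v(1) assms(3,4) by (auto simp: is_sum_def proportional_sym)
  then show ?thesis
    using proportional_trans u(2) v(2) unfolding sim_def by blast
qed

text \<open>With law 0 nonzero on the inner sums, \<open>a\<close> and \<open>c\<close> agree with
  its values up to nonzero scalars, so the polynomial identities apply. A nonzero law
  \<open>u\<close> for a + r and \<open>v\<close> for p + c then link \<open>b\<close> to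
  \<open>d\<close>.\<close>

lemma is_sum_assoc_x_aux:
  assumes curve: "on_curve t p" "on_curve t q" "on_curve t r" "on_curve t a" "on_curve t c"
    and sum: "is_sum t p q a" "is_sum t q r c" "is_sum t a r b" "is_sum t p c d"
    and law0: "law0_nz t p q" "law0_nz t q r"
  shows "proportional (fst b) (fst d)"
proof -
  define a' where "a' = (x_law0 t p q, y_law0 t p q)"
  define c' where "c' = (x_law0 t q r, y_law0 t q r)"
  have "sim a a'" "sim c c'"
    using sum(1,2) by (simp_all add: sim_def a'_def c'_def is_sum_def)
  have nz: "nz (fst a)" "nz (snd a)" "nz (fst c)" "nz (snd c)"
    using on_curve_nz[OF curve(4)] on_curve_nz[OF curve(5)] by blast+
  have nz': "nz (fst a')" "nz (snd a')" "nz (fst c')" "nz (snd c')"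
    using law0 by (simp_all add: law0_nz_def a'_def c'_def)
  obtain k l where kl: "k \<noteq> 0" "l \<noteq> 0"
    and a: "a = ((k * fst (fst a'), k * snd (fst a')), (l * fst (snd a'), l * snd (snd a')))"
    using sim_scale[OF \<open>sim a a'\<close> nz(1,2) nz'(1,2)] .
  obtain m n where mn: "m \<noteq> 0" "n \<noteq> 0"
    and c: "c = ((m * fst (fst c'), m * snd (fst c')), (n * fst (snd c'), n * snd (snd c')))"
    using sim_scale[OF \<open>sim c c'\<close> nz(3,4) nz'(3,4)] .
  have left: "proportional (x_law0 t a r) u \<longleftrightarrow> proportional (x_law0 t a' r) u"
    "proportional (x_law1 a r) u \<longleftrightarrow> proportional (x_law1 a' r) u" for u
    using kl by (simp_all add: law_scale[OF a])
  have right: "proportional u (x_law0 t p c) \<longleftrightarrow> proportional u (x_law0 t p c')"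
    "proportional u (x_law1 p c) \<longleftrightarrow> proportional u (x_law1 p c')" for u
  proof -
    \<comment> \<open>\<open>law_scale\<close> concerns the first argument; scaling the second goes
      through commutation, at the cost of a sign.\<close>
    have *: "proportional u (x_law1 p q) \<longleftrightarrow> proportional u (x_law1 q p)" for q
      by (simp add: law_commute(3)[of p q] proportional_def)
    show "proportional u (x_law0 t p c) \<longleftrightarrow> proportional u (x_law0 t p c')"
      using mn by (simp add: law_commute(1)[of t p] law_scale[OF c])
    show "proportional u (x_law1 p c) \<longleftrightarrow> proportional u (x_law1 p c')"
      using mn by (simp add: * law_scale[OF c])
  qed
  have laws: "proportional (x_law0 t a r) (x_law0 t p c)" "proportional (x_law0 t a r) (x_law1 p c)"
    "proportional (x_law1 a r) (x_law0 t p c)" "proportional (x_law1 a r) (x_law1 p c)"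
    unfolding left right a'_def c'_def by (rule proportional_assoc[OF curve(1-3)])+
  obtain u where u: "u = x_law0 t a r \<or> u = x_law1 a r" "nz u"
    using law0_nz_or_law1_nz[OF two_nz t_nz t_square curve(4,3)]
    unfolding law0_nz_def law1_nz_def by blast
  obtain v where v: "v = x_law0 t p c \<or> v = x_law1 p c" "nz v"
    using law0_nz_or_law1_nz[OF two_nz t_nz t_square curve(1,5)]
    unfolding law0_nz_def law1_nz_def by blast
  have "proportional u v" "proportional (fst b) u" "proportional (fst d) v"
    using laws u(1) v(1) sum(3,4) by (auto simp: is_sum_def)
  then show ?thesis
    using proportional_trans[OF proportional_trans[OF _ _ u(2)] proportional_sym v(2)] by simp
qed

lemma proportional_tau: "proportional (fst (tau_pp t b)) (fst (tau_pp t d)) \<longleftrightarrow> proportional (fst b) (fst d)"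
  using proportional_swap[OF t_nz, of "fst b" "fst d"]
  by (cases "(t, b)" rule: tau_pp.cases; cases "(t, d)" rule: tau_pp.cases) simp

lemma is_sum_assoc_x:
  assumes curve: "on_curve t p" "on_curve t q" "on_curve t r" "on_curve t a" "on_curve t c"
    and sum: "is_sum t p q a" "is_sum t q r c" "is_sum t a r b" "is_sum t p c d"
  shows "proportional (fst b) (fst d)"
proof -
  \<comment> \<open>Kept general in \<open>r\<close>, \<open>c\<close>, \<open>b\<close>,
    \<open>d\<close> so that it also applies after translating \<open>r\<close>, which translates
    \<open>c\<close>, \<open>b\<close> and \<open>d\<close>. Translating \<open>p\<close> inside
    this step translates \<open>a\<close>, \<open>b\<close> and \<open>d\<close>.\<close>
  have step: "proportional (fst b) (fst d)"
    if "on_curve t r" "on_curve t c" "is_sum t q r c" "is_sum t a r b" "is_sum t p c d"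
      "law0_nz t q r" for r c b d
  proof (cases "law0_nz t p q")
    case True
    then show ?thesis
      using is_sum_assoc_x_aux curve(1,2,4) sum(1) that by blast
  next
    case False
    then have "law0_nz t (tau_pp t p) q"
      using law0_nz_or_law1_nz[OF two_nz t_nz t_square curve(1,2)] law0_nz_tau[OF t_nz] by blast
    then have "proportional (fst (tau_pp t b)) (fst (tau_pp t d))"
      using curve(1,2,4) sum(1) that
      by (intro is_sum_assoc_x_aux[of "tau_pp t p" q r "tau_pp t a" c])
        (simp_all add: on_curve_tau is_sum_tau_left t_nz)
    then show ?thesis
      by (simp add: proportional_tau)
  qed
  show ?thesis
  proof (cases "law0_nz t q r")
    case True
    then show ?thesis
      using step curve sum by blast
  next
    case False
    then have "law0_nz t q (tau_pp t r)"
      using law0_nz_or_law1_nz[OF two_nz t_nz t_square curve(2,3)] law0_nz_tau[OF t_nz]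
        law_nz_commute by metis
    then have "proportional (fst (tau_pp t b)) (fst (tau_pp t d))"
      using curve sum by (intro step[of "tau_pp t r" "tau_pp t c"])
        (simp_all add: on_curve_tau is_sum_tau_right t_nz)
    then show ?thesis
      by (simp add: proportional_tau)
  qed
qed

text \<open>Rotating \<open>p\<close> rotates \<open>a\<close>, \<open>b\<close> and
  \<open>d\<close>, which turns the second coordinates of \<open>b\<close> and \<open>d\<close> into
  first ones, up to sign.\<close>

lemma is_sum_assoc:
  assumes curve: "on_curve t p" "on_curve t q" "on_curve t r" "on_curve t a" "on_curve t c"
    and sum: "is_sum t p q a" "is_sum t q r c" "is_sum t a r b" "is_sum t p c d"
  shows "sim b d"
proof -
  have "proportional (fst (rot b)) (fst (rot d))"
    using curve sum by (intro is_sum_assoc_x[of "rot p" q r "rot a" c])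
      (simp_all add: on_curve_rot is_sum_rot)
  then have "proportional (snd b) (snd d)"
    by (cases b rule: rot.cases; cases d rule: rot.cases) (simp add: proportional_def)
  then show ?thesis
    using is_sum_assoc_x[OF assms] by (simp add: sim_def)
qed

section \<open>The glued curve\<close>

lemma is_sum_cong_left:
  assumes "sim p p'" "on_curve t p" "on_curve t p'"
  shows "is_sum t p q r \<longleftrightarrow> is_sum t p' q r"
proof -
  have nz: "nz (fst p)" "nz (snd p)" "nz (fst p')" "nz (snd p')"
    using on_curve_nz[OF assms(2)] on_curve_nz[OF assms(3)] by auto
  obtain k l where kl: "k \<noteq> 0" "l \<noteq> 0"
    and p: "p = ((k * fst (fst p'), k * snd (fst p')), (l * fst (snd p'), l * snd (snd p')))"
    using sim_scale[OF assms(1) nz] .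
  show ?thesis
    using kl by (simp add: is_sum_def law_scale[OF p])
qed

lemma is_sum_cong_right:
  assumes "sim r r'" "on_curve t r" "on_curve t r'"
  shows "is_sum t p q r \<longleftrightarrow> is_sum t p q r'"
proof -
  have *: "proportional a u \<longleftrightarrow> proportional b u" if "proportional a b" "nz a" "nz b" for a b u :: "'a \<times> 'a"
    using that proportional_trans[of b a u] proportional_trans[of a b u] proportional_sym[of a b]
    by blast
  have "proportional (fst r) u \<longleftrightarrow> proportional (fst r') u" "proportional (snd r) u \<longleftrightarrow> proportional (snd r') u" for u
    using assms(1) on_curve_nz[OF assms(2)] on_curve_nz[OF assms(3)] unfolding sim_def
    by (simp_all add: *[of "fst r" "fst r'"] *[of "snd r" "snd r'"])
  then show ?thesis
    by (simp add: is_sum_def)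
qed

section \<open>Embedding of the two affine copies\<close>

fun pp_of :: "'a \<times> 'a \<Rightarrow> bit \<Rightarrow> 'a pp" where
  "pp_of (x, y) i = (if i = 0 then ((x, 1), (y, 1)) else ((1, t * x), (1, t * y)))"

lemma pp_of_1: "pp_of P 1 = tau_pp t (pp_of P 0)"
  by (cases P) simp

lemma bit_cases [case_names 0 1]: "(i = (0::bit) \<Longrightarrow> thesis) \<Longrightarrow> (i = 1 \<Longrightarrow> thesis) \<Longrightarrow> thesis"
  by (cases i) auto

lemma mem_E_aff_iff: "(x, y) \<in> E_aff t \<longleftrightarrow> x\<^sup>2 + y\<^sup>2 = 1 + t\<^sup>2 * x\<^sup>2 * y\<^sup>2"
  by (simp add: E_aff_def edwards_e_def diff_eq_eq add_ac)

lemma on_curve_pp_of: "P \<in> E_aff t \<Longrightarrow> on_curve t (pp_of P i)"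
proof -
  assume "P \<in> E_aff t"
  then have "on_curve t (pp_of P 0)"
    by (cases P) (simp add: mem_E_aff_iff nz_def)
  then show ?thesis
    using pp_of_1 on_curve_tau[OF t_nz] by (cases i rule: bit_cases) auto
qed

text \<open>Within one copy, vanishing cross products mean equal points. Between the copies they
  mean t x1 x2 = 1 and t y1 y2 = 1, which is the relation by \<open>tau\<close>.\<close>

lemma glue_iff:
  assumes "P \<in> E_aff t" "Q \<in> E_aff t"
  shows "((P, i), (Q, j)) \<in> glue t \<longleftrightarrow> sim (pp_of P i) (pp_of Q j)"
proof -
  obtain x1 y1 where P: "P = (x1, y1)" by (cases P)
  obtain x2 y2 where Q: "Q = (x2, y2)" by (cases Q)
  \<comment> \<open>The division-free form also encodes that the coordinate is nonzero.\<close>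
  have *: "x \<noteq> 0 \<and> x' = 1 / (t * x) \<longleftrightarrow> t * x * x' = 1" for x x'
    using t_nz by (cases "x = 0") (simp_all add: eq_divide_eq mult.commute)
  have tau: "P \<in> E_circ t \<and> Q = tau t P \<longleftrightarrow> t * x1 * x2 = 1 \<and> t * y1 * y2 = 1"
    unfolding *[symmetric] using assms(1) by (auto simp: P Q E_circ_def)
  have mem: "((P, i), (Q, j)) \<in> glue t \<longleftrightarrow>
      P = Q \<and> i = j \<or> t * x1 * x2 = 1 \<and> t * y1 * y2 = 1 \<and> j = i + 1"
    using assms tau by (auto simp: glue_def)
  show ?thesis
  proof (cases "i = j")
    case True
    have "sim (pp_of P i) (pp_of Q i) \<longleftrightarrow> P = Q"
      using t_nz by (cases i rule: bit_cases) (auto simp: P Q sim_def proportional_def)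
    then show ?thesis
      using True mem by (cases i rule: bit_cases) simp_all
  next
    case False
    then have "j = i + 1"
      by (cases i rule: bit_cases; cases j rule: bit_cases) simp_all
    moreover have "sim (pp_of P i) (pp_of Q (i + 1)) \<longleftrightarrow> t * x1 * x2 = 1 \<and> t * y1 * y2 = 1"
      by (cases i rule: bit_cases) (auto simp: P Q sim_def proportional_def mult_ac)
    ultimately show ?thesis
      using False mem by simp
  qed
qed

lemma pt_class_eq_iff:
  assumes "P \<in> E_aff t" "Q \<in> E_aff t"
  shows "pt_class t P i = pt_class t Q j \<longleftrightarrow> sim (pp_of P i) (pp_of Q j)"
  using eq_equiv_class_iff[OF equiv_glue[OF t_nz], of "(P, i)" "(Q, j)"] assms glue_iff
  by (simp add: pt_class_def)

lemma mem_edwards_E_iff: "X \<in> edwards_E t \<longleftrightarrow> (\<exists>P\<in>E_aff t. \<exists>i. X = pt_class t P i)"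
  by (auto simp: edwards_E_def pt_class_def quotient_def)

section \<open>Transfer of sums to glued classes\<close>

text \<open>An arbitrary choice of coordinates; it is harmless because \<open>is_sum\<close>
  respects \<open>sim\<close> between curve points.\<close>

definition rep :: "(('a \<times> 'a) \<times> bit) set \<Rightarrow> 'a pp" where
  "rep X = (SOME p. \<exists>P\<in>E_aff t. \<exists>i. X = pt_class t P i \<and> p = pp_of P i)"

lemma rep:
  assumes "X \<in> edwards_E t"
  shows "\<exists>P\<in>E_aff t. \<exists>i. X = pt_class t P i \<and> rep X = pp_of P i"
proof -
  have "\<exists>p. \<exists>P\<in>E_aff t. \<exists>i. X = pt_class t P i \<and> p = pp_of P i"
    using assms unfolding mem_edwards_E_iff by blast
  from someI_ex[OF this] show ?thesis
    unfolding rep_def by blast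
qed

lemma on_curve_rep: "X \<in> edwards_E t \<Longrightarrow> on_curve t (rep X)"
  using rep[of X] on_curve_pp_of by auto

lemma sim_rep_iff:
  assumes "X \<in> edwards_E t" "Y \<in> edwards_E t"
  shows "sim (rep X) (rep Y) \<longleftrightarrow> X = Y"
proof -
  obtain P i where "P \<in> E_aff t" "X = pt_class t P i" "rep X = pp_of P i"
    using rep[OF assms(1)] by blast
  moreover obtain Q j where "Q \<in> E_aff t" "Y = pt_class t Q j" "rep Y = pp_of Q j"
    using rep[OF assms(2)] by blast
  ultimately show ?thesis
    using pt_class_eq_iff by simp
qed

lemma sim_rep_pt_class: "P \<in> E_aff t \<Longrightarrow> sim (rep (pt_class t P i)) (pp_of P i)"
proof -
  assume P: "P \<in> E_aff t"
  then have "pt_class t P i \<in> edwards_E t"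
    using mem_edwards_E_iff by blast
  from rep[OF this] obtain Q j where "Q \<in> E_aff t" "pt_class t P i = pt_class t Q j"
    "rep (pt_class t P i) = pp_of Q j"
    by blast
  then show ?thesis
    using P pt_class_eq_iff sim_sym by metis
qed

lemma is_sum_rep_iff:
  assumes "P \<in> E_aff t" "Q \<in> E_aff t" "R \<in> E_aff t"
  shows "is_sum t (rep (pt_class t P i)) (rep (pt_class t Q j)) (rep (pt_class t R k)) \<longleftrightarrow>
    is_sum t (pp_of P i) (pp_of Q j) (pp_of R k)"
proof -
  have curve: "on_curve t (rep (pt_class t S l))" if "S \<in> E_aff t" for S l
    using on_curve_rep that mem_edwards_E_iff by blast
  note left = is_sum_cong_left[OF sim_rep_pt_class curve on_curve_pp_of]
  have "is_sum t (rep (pt_class t P i)) (rep (pt_class t Q j)) (rep (pt_class t R k)) \<longleftrightarrow>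
      is_sum t (pp_of P i) (rep (pt_class t Q j)) (rep (pt_class t R k))"
    using assms left by blast
  also have "\<dots> \<longleftrightarrow> is_sum t (rep (pt_class t Q j)) (pp_of P i) (rep (pt_class t R k))"
    by (rule is_sum_commute)
  also have "\<dots> \<longleftrightarrow> is_sum t (pp_of Q j) (pp_of P i) (rep (pt_class t R k))"
    using assms left by blast
  also have "\<dots> \<longleftrightarrow> is_sum t (pp_of P i) (pp_of Q j) (rep (pt_class t R k))"
    by (rule is_sum_commute)
  also have "\<dots> \<longleftrightarrow> is_sum t (pp_of P i) (pp_of Q j) (pp_of R k)"
    using assms by (intro is_sum_cong_right sim_rep_pt_class curve on_curve_pp_of)
  finally show ?thesis .
qed

text \<open>Copy 1 is the \<open>tau_pp\<close> translate of copy 0, and two translations cancel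
  just as 1 + 1 = 0 in the index.\<close>

lemma is_sum_pp_of:
  "is_sum t (pp_of P i) (pp_of Q j) (pp_of R (i + j)) \<longleftrightarrow>
    is_sum t (pp_of P 0) (pp_of Q 0) (pp_of R 0)"
  by (cases i rule: bit_cases; cases j rule: bit_cases)
    (simp_all add: pp_of_1 is_sum_tau_left is_sum_tau_right is_sum_tau_tau t_nz del: pp_of.simps)

lemma oplus:
  assumes PQ: "P \<in> E_aff t" "Q \<in> E_aff t" and delta: "delta t l P Q \<noteq> 0"
  shows "oplus t l P Q \<in> E_aff t"
    and "is_sum t (pp_of P i) (pp_of Q j) (pp_of (oplus t l P Q) (i + j))"
proof -
  obtain x1 y1 where P: "P = (x1, y1)" by (cases P)
  obtain x2 y2 where Q: "Q = (x2, y2)" by (cases Q)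
  define u where "u = (if l = 0 then x_law0 t (pp_of P 0) (pp_of Q 0) else x_law1 (pp_of P 0) (pp_of Q 0))"
  define v where "v = (if l = 0 then y_law0 t (pp_of P 0) (pp_of Q 0) else y_law1 (pp_of P 0) (pp_of Q 0))"
  have snd_nz: "snd u \<noteq> 0" "snd v \<noteq> 0"
    using delta by (auto simp: P Q u_def v_def delta_def split: if_splits)
  have R: "oplus t l P Q = (fst u / snd u, fst v / snd v)"
    by (simp add: P Q u_def v_def oplus_def)
  have e: "x1\<^sup>2 + y1\<^sup>2 = 1 + t\<^sup>2 * x1\<^sup>2 * y1\<^sup>2" "x2\<^sup>2 + y2\<^sup>2 = 1 + t\<^sup>2 * x2\<^sup>2 * y2\<^sup>2"
    using PQ by (simp_all add: P Q mem_E_aff_iff)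
  \<comment> \<open>The curve equation of the sum with denominators cleared; it follows from those
    of \<open>P\<close> and \<open>Q\<close>.\<close>
  have "(fst u)\<^sup>2 * (snd v)\<^sup>2 + (fst v)\<^sup>2 * (snd u)\<^sup>2 =
      (snd u)\<^sup>2 * (snd v)\<^sup>2 + t\<^sup>2 * (fst u)\<^sup>2 * (fst v)\<^sup>2"
  proof (cases "l = 0")
    case True
    have uv: "u = (x1 * x2 - y1 * y2, 1 - t\<^sup>2 * x1 * x2 * y1 * y2)"
      "v = (x1 * y2 + y1 * x2, 1 + t\<^sup>2 * x1 * x2 * y1 * y2)"
      using True by (simp_all add: P Q u_def v_def)
    show ?thesis
      unfolding uv fst_conv snd_conv using e by algebra
  next
    case False
    have uv: "u = (x1 * y1 - x2 * y2, x2 * y1 - x1 * y2)" "v = (x1 * y1 + x2 * y2, x1 * x2 + y1 * y2)"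
      using False by (simp_all add: P Q u_def v_def)
    show ?thesis
      unfolding uv fst_conv snd_conv using e by algebra
  qed
  then show "oplus t l P Q \<in> E_aff t"
    using snd_nz by (simp add: R mem_E_aff_iff field_simps)
  \<comment> \<open>The law in use is proportional to itself and, on the curve, to the other
    law.\<close>
  have "proportional u (x_law0 t (pp_of P 0) (pp_of Q 0))" "proportional u (x_law1 (pp_of P 0) (pp_of Q 0))"
    "proportional v (y_law0 t (pp_of P 0) (pp_of Q 0))" "proportional v (y_law1 (pp_of P 0) (pp_of Q 0))"
    using proportional_law[OF on_curve_pp_of[OF PQ(1), of 0] on_curve_pp_of[OF PQ(2), of 0]]
    by (auto simp: u_def v_def proportional_def)
  moreover have "proportional (fst u / snd u, 1) u" "proportional (fst v / snd v, 1) v" "nz u" "nz v"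
    using snd_nz by (auto simp: proportional_def nz_def)
  ultimately have "is_sum t (pp_of P 0) (pp_of Q 0) (pp_of (oplus t l P Q) 0)"
    using proportional_trans[of "(fst u / snd u, 1)" u] proportional_trans[of "(fst v / snd v, 1)" v]
    by (simp add: is_sum_def R)
  then show "is_sum t (pp_of P i) (pp_of Q j) (pp_of (oplus t l P Q) (i + j))"
    by (simp only: is_sum_pp_of)
qed

section \<open>Existence and uniqueness of the value of the rule\<close>

text \<open>The rule needs nonzero denominators, not just nonzero pairs. If all four products
  vanish, then s = x1^2 = y1^2 satisfies 2 s = 1 + t^2 s^2 and (t^2 s^2)^2 = 1. The value t^2 s^2 =
  1 gives s = 1 and t^2 = 1; the value -1 gives s = 0.\<close>

lemma delta_tau_nonzero:
  assumes "P \<in> E_circ t" "Q \<in> E_circ t"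
  shows "\<exists>l. delta t l P Q \<noteq> 0 \<or> delta t l (tau t P) Q \<noteq> 0"
proof (rule ccontr)
  assume "\<not> ?thesis"
  then have "delta t l P Q = 0" "delta t l (tau t P) Q = 0" for l
    by blast+
  from this[of 0] this[of 1]
  have zero: "delta0 t P Q = 0" "delta1 P Q = 0" "delta0 t (tau t P) Q = 0" "delta1 (tau t P) Q = 0"
    by (simp_all add: delta_def)
  obtain x1 y1 where P: "P = (x1, y1)" by (cases P)
  obtain x2 y2 where Q: "Q = (x2, y2)" by (cases Q)
  have nz: "x1 \<noteq> 0" "y1 \<noteq> 0" "x2 \<noteq> 0" "y2 \<noteq> 0" and e: "x1\<^sup>2 + y1\<^sup>2 = 1 + t\<^sup>2 * x1\<^sup>2 * y1\<^sup>2"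
    using assms by (auto simp: P Q E_circ_def mem_E_aff_iff)
  have "(1 - t\<^sup>2 * x1 * x2 * y1 * y2) * (1 + t\<^sup>2 * x1 * x2 * y1 * y2) = 0"
    using zero(1) by (simp add: P Q)
  then have l: "(t\<^sup>2)\<^sup>2 * (x1\<^sup>2 * y1\<^sup>2) * (x2\<^sup>2 * y2\<^sup>2) = 1"
    by algebra
  have d1: "x2 * y1 - x1 * y2 = 0 \<or> x1 * x2 + y1 * y2 = 0"
    using zero(2) by (simp add: P Q)
  have "delta1 (tau t P) Q = (x1 * x2 - y1 * y2) * (y1 * x2 + x1 * y2) / (t * x1 * y1)\<^sup>2"
    using nz t_nz by (simp add: P Q field_simps power2_eq_square)
  then have d1': "x1 * x2 - y1 * y2 = 0 \<or> y1 * x2 + x1 * y2 = 0"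
    using zero(4) nz t_nz by simp
  have "delta0 t (tau t P) Q = (x1\<^sup>2 * y1\<^sup>2 - x2\<^sup>2 * y2\<^sup>2) / (x1\<^sup>2 * y1\<^sup>2)"
    using nz t_nz by (simp add: P Q field_simps power2_eq_square)
  then have m: "x1\<^sup>2 * y1\<^sup>2 = x2\<^sup>2 * y2\<^sup>2"
    using zero(3) nz by simp
  have x1y1: "x1\<^sup>2 = y1\<^sup>2"
  proof -
    have "2 * (x2 * y1) \<noteq> 0" "2 * (x1 * x2) \<noteq> 0"
      using nz two_nz by auto
    moreover have "2 * (x2 * y1) = (x2 * y1 - x1 * y2) + (y1 * x2 + x1 * y2)"
      "2 * (x1 * x2) = (x1 * x2 + y1 * y2) + (x1 * x2 - y1 * y2)"
      \<comment> \<open>Of the four combinations of \<open>d1\<close> and \<open>d1'\<close>, these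
        sums rule out two; either remaining one yields x1^2 = y1^2.\<close>
      by (simp_all add: algebra_simps)
    ultimately have "x2 * y1 - x1 * y2 = 0 \<and> x1 * x2 - y1 * y2 = 0 \<or>
        x1 * x2 + y1 * y2 = 0 \<and> y1 * x2 + x1 * y2 = 0"
      using d1 d1' by (metis add_0)
    then have "x2 * y2 * (x1\<^sup>2 - y1\<^sup>2) = 0"
      by (elim disjE conjE) algebra+
    then show ?thesis
      using nz by simp
  qed
  define s where "s = x1\<^sup>2"
  have sq: "x1\<^sup>2 = s" "y1\<^sup>2 = s"
    using x1y1 by (simp_all add: s_def)
  have "s + s = 1 + t\<^sup>2 * s * s" "(t\<^sup>2)\<^sup>2 * (s * s) * (s * s) = 1"
    using e l unfolding m[symmetric] sq by simp_all
  then have s: "2 * s = 1 + t\<^sup>2 * s\<^sup>2" "(t\<^sup>2 * s\<^sup>2)\<^sup>2 = 1"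
    by (simp_all add: power2_eq_square mult_ac)
  then have "t\<^sup>2 * s\<^sup>2 = 1 \<or> t\<^sup>2 * s\<^sup>2 = - 1"
    by (simp add: power2_eq_1_iff)
  then show False
  proof
    assume "t\<^sup>2 * s\<^sup>2 = 1"
    then have "2 * (s - 1) = 0"
      using s(1) by (simp add: algebra_simps)
    then show False
      using \<open>t\<^sup>2 * s\<^sup>2 = 1\<close> two_nz t_square by simp
  next
    assume "t\<^sup>2 * s\<^sup>2 = - 1"
    then show False
      using s(1) nz two_nz by (simp add: s_def)
  qed
qed

lemma delta0_eq_1:
  assumes "P \<in> E_aff t" "Q \<in> E_aff t" "P \<notin> E_circ t \<or> Q \<notin> E_circ t"
  shows "delta t 0 P Q = 1"
  using assms by (cases P; cases Q) (auto simp: E_circ_def delta_def)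

lemma E_circ_E_aff: "P \<in> E_circ t \<Longrightarrow> P \<in> E_aff t"
  by (auto simp: E_circ_def)

lemma pt_class_tau:
  assumes "P \<in> E_circ t"
  shows "pt_class t P i = pt_class t (tau t P) (i + 1)"
proof -
  have "((P, i), (tau t P, i + 1)) \<in> glue t"
    using assms tau_E_circ(1)[OF t_nz assms] E_circ_E_aff by (simp add: glue_def)
  then show ?thesis
    unfolding pt_class_def by (rule equiv_class_eq[OF equiv_glue[OF t_nz]])
qed

text \<open>When both points lie in \<open>E_circ t\<close>, \<open>P\<close> may be traded for
  \<open>tau t P\<close> in the other copy. Otherwise a coordinate is zero and \<open>delta0\<close>
  equals 1.\<close>

lemma sum_rule_ex:
  assumes "X \<in> edwards_E t" "Y \<in> edwards_E t"
  shows "\<exists>Z. sum_rule t X Y Z"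
proof -
  obtain P i where P: "P \<in> E_aff t" "X = pt_class t P i"
    using assms(1) mem_edwards_E_iff by blast
  obtain Q j where Q: "Q \<in> E_aff t" "Y = pt_class t Q j"
    using assms(2) mem_edwards_E_iff by blast
  have "\<exists>P'\<in>E_aff t. \<exists>i' l. X = pt_class t P' i' \<and> delta t l P' Q \<noteq> 0"
  proof (cases "P \<in> E_circ t \<and> Q \<in> E_circ t")
    case True
    then have "tau t P \<in> E_aff t"
      using tau_E_circ(1)[OF t_nz] E_circ_E_aff by blast
    then show ?thesis
      using True delta_tau_nonzero[of P Q] P pt_class_tau by blast
  next
    case False
    then have "delta t 0 P Q \<noteq> 0"
      using delta0_eq_1[OF P(1) Q(1)] by simp
    then show ?thesis
      using P by blast
  qed
  then show ?thesis
    using Q unfolding sum_rule_def by blast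
qed

lemma sum_rule_is_sum:
  assumes "sum_rule t X Y Z"
  shows "Z \<in> edwards_E t" "is_sum t (rep X) (rep Y) (rep Z)"
proof -
  obtain P Q i j l where *: "P \<in> E_aff t" "Q \<in> E_aff t" "X = pt_class t P i" "Y = pt_class t Q j"
    "delta t l P Q \<noteq> 0" "Z = pt_class t (oplus t l P Q) (i + j)"
    using assms unfolding sum_rule_def by (elim bexE exE conjE) (rule that)
  show "Z \<in> edwards_E t"
    using oplus(1)[OF *(1,2,5)] *(6) unfolding mem_edwards_E_iff by blast
  show "is_sum t (rep X) (rep Y) (rep Z)"
    unfolding *(3,4,6) is_sum_rep_iff[OF *(1,2) oplus(1)[OF *(1,2,5)]]
    by (rule oplus(2)[OF *(1,2,5)])
qed

lemma is_sum_rep_unique: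
  assumes "X \<in> edwards_E t" "Y \<in> edwards_E t" "Z \<in> edwards_E t" "Z' \<in> edwards_E t"
    "is_sum t (rep X) (rep Y) (rep Z)" "is_sum t (rep X) (rep Y) (rep Z')"
  shows "Z = Z'"
  using is_sum_unique[OF on_curve_rep[OF assms(1)] on_curve_rep[OF assms(2)] assms(5,6)]
  by (simp add: sim_rep_iff[OF assms(3,4)])

text \<open>Every value of the rule satisfies \<open>is_sum\<close>, which determines the class.
  This justifies the definite description in \<open>edwards_add\<close>.\<close>

lemma sum_rule_iff:
  assumes "X \<in> edwards_E t" "Y \<in> edwards_E t"
  shows "sum_rule t X Y Z \<longleftrightarrow> Z = edwards_add t X Y"
proof -
  obtain Z' where Z': "sum_rule t X Y Z'"
    using sum_rule_ex[OF assms] by blast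
  have unique: "W = Z'" if "sum_rule t X Y W" for W
    by (rule is_sum_rep_unique[OF assms sum_rule_is_sum(1)[OF that] sum_rule_is_sum(1)[OF Z']
          sum_rule_is_sum(2)[OF that] sum_rule_is_sum(2)[OF Z']])
  have add: "edwards_add t X Y = Z'"
    unfolding edwards_add_def using Z' unique by (rule the_equality)
  then show ?thesis
    unfolding add using unique Z' by blast
qed

lemma edwards_add_closed:
  assumes "X \<in> edwards_E t" "Y \<in> edwards_E t"
  shows "edwards_add t X Y \<in> edwards_E t"
  by (rule sum_rule_is_sum(1)[OF iffD2[OF sum_rule_iff[OF assms] refl]])

lemma is_sum_edwards_add:
  assumes "X \<in> edwards_E t" "Y \<in> edwards_E t"
  shows "is_sum t (rep X) (rep Y) (rep (edwards_add t X Y))"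
  by (rule sum_rule_is_sum(2)[OF iffD2[OF sum_rule_iff[OF assms] refl]])

lemma edwards_add_eqI:
  assumes "X \<in> edwards_E t" "Y \<in> edwards_E t" "Z \<in> edwards_E t" "is_sum t (rep X) (rep Y) (rep Z)"
  shows "edwards_add t X Y = Z"
  by (rule is_sum_rep_unique[OF assms(1,2) edwards_add_closed[OF assms(1,2)] assms(3)
        is_sum_edwards_add[OF assms(1,2)] assms(4)])

section \<open>Group axioms\<close>

lemma edwards_add_commute:
  "X \<in> edwards_E t \<Longrightarrow> Y \<in> edwards_E t \<Longrightarrow> edwards_add t X Y = edwards_add t Y X"
  by (intro edwards_add_eqI edwards_add_closed is_sum_edwards_add
      iffD2[OF is_sum_commute[of t "rep X" "rep Y"]])

lemma edwards_add_assoc: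
  assumes "X \<in> edwards_E t" "Y \<in> edwards_E t" "Z \<in> edwards_E t"
  shows "edwards_add t (edwards_add t X Y) Z = edwards_add t X (edwards_add t Y Z)"
proof -
  have "sim (rep (edwards_add t (edwards_add t X Y) Z)) (rep (edwards_add t X (edwards_add t Y Z)))"
    by (rule is_sum_assoc[of "rep X" "rep Y" "rep Z" "rep (edwards_add t X Y)" "rep (edwards_add t Y Z)"])
      (intro on_curve_rep is_sum_edwards_add edwards_add_closed assms)+
  then show ?thesis
    using sim_rep_iff edwards_add_closed assms by simp
qed

text \<open>Formally at t = 0 the law \<open>oplus0\<close> is addition of angles on the unit
  circle, where (1, 0) is neutral.\<close>

definition origin :: "(('a \<times> 'a) \<times> bit) set" where
  "origin = pt_class t (1, 0) 0"

lemma origin_E_aff: "(1, 0) \<in> E_aff t"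
  by (simp add: mem_E_aff_iff)

lemma origin_closed: "origin \<in> edwards_E t"
  unfolding origin_def using origin_E_aff mem_edwards_E_iff by blast

lemma origin_add:
  assumes "X \<in> edwards_E t"
  shows "edwards_add t origin X = X"
proof (rule edwards_add_eqI[OF origin_closed assms assms])
  obtain x y i where X: "(x, y) \<in> E_aff t" "X = pt_class t (x, y) i"
    using assms mem_edwards_E_iff by auto
  have "is_sum t (pp_of (1, 0) 0) (pp_of (x, y) i) (pp_of (x, y) (0 + i))"
    unfolding is_sum_pp_of by (simp add: is_sum_def proportional_def)
  then show "is_sum t (rep origin) (rep X) (rep X)"
    unfolding origin_def X(2) is_sum_rep_iff[OF origin_E_aff X(1) X(1)] by simp
qed

text \<open>As on the circle, the inverse is the reflection (x, -y), taken in the same copy. The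
  curve equation makes numerator and denominator of the first coordinate equal under law 0.\<close>

lemma ex_inverse:
  assumes "X \<in> edwards_E t"
  shows "\<exists>Y\<in>edwards_E t. edwards_add t Y X = origin"
proof -
  obtain x y i where X: "(x, y) \<in> E_aff t" "X = pt_class t (x, y) i"
    using assms mem_edwards_E_iff by auto
  have neg: "(x, - y) \<in> E_aff t"
    using X(1) by (simp add: mem_E_aff_iff)
  have "is_sum t (pp_of (x, - y) i) (pp_of (x, y) i) (pp_of (1, 0) (i + i))"
    unfolding is_sum_pp_of using X(1)
    by (simp add: is_sum_def proportional_def mem_E_aff_iff power2_eq_square mult_ac)
  moreover have "i + i = 0"
    by (cases i rule: bit_cases) simp_all
  ultimately have "is_sum t (rep (pt_class t (x, - y) i)) (rep X) (rep origin)"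
    unfolding origin_def X(2) is_sum_rep_iff[OF neg X(1) origin_E_aff] by simp
  moreover have "pt_class t (x, - y) i \<in> edwards_E t"
    using neg mem_edwards_E_iff by blast
  ultimately show ?thesis
    using edwards_add_eqI[OF _ assms origin_closed] by blast
qed

lemma comm_group_edwards:
  "comm_group \<lparr>carrier = edwards_E t, monoid.mult = edwards_add t, one = origin\<rparr>"
  by (rule comm_groupI; (simp add: edwards_add_closed origin_closed edwards_add_assoc origin_add
        ex_inverse; rule edwards_add_commute; assumption))

end

theorem theorem4p4p1:
  fixes t :: "'a::field"
  assumes "CHAR('a) \<noteq> 2" and "t \<noteq> 0" and "t\<^sup>2 \<noteq> 1"
  shows "(\<forall>X\<in>edwards_E t. \<forall>Y\<in>edwards_E t.
            \<exists>Z\<in>edwards_E t. \<forall>W. sum_rule t X Y W \<longleftrightarrow> W = Z) \<and>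
         (\<exists>e. comm_group \<lparr>carrier = edwards_E t, monoid.mult = edwards_add t, one = e\<rparr>)"
proof -
  \<comment> \<open>Otherwise the characteristic divides 2; being different from 1, it would be
    2.\<close>
  have "(2::'a) \<noteq> 0"
  proof
    assume "(2::'a) = 0"
    then have "of_nat 2 = (0::'a)"
      by simp
    then have "CHAR('a) dvd 2"
      by (simp only: of_nat_eq_0_iff_char_dvd)
    moreover from this have "CHAR('a) \<le> 2"
      by (rule dvd_imp_le) simp
    moreover have "CHAR('a) \<noteq> 1"
      by simp
    ultimately show False
      using assms(1) by (cases "CHAR('a) = 0") auto
  qed
  then interpret edwards t
    using assms by unfold_locales
  show ?thesis
    using sum_rule_iff edwards_add_closed comm_group_edwards by auto
qed

end
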